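(* For every positive integer $n$, there exists a set $\mathcal{P} \subseteq \left(\tfrac{1}{2}\mathbb{Z}\right)^n$ with $|\mathcal{P}| = 2^n$ such that for all distinct $\mathbf{p}, \mathbf{q} \in \mathcal{P}$, the $\ell_1$-distance $\|\mathbf{p}-\mathbf{q}\|_1 = \sum_{i=1}^n |p_i - q_i|$ is an odd integer. In particular, $\mathrm{odd}_1(n) \geq 2^n$.
   Context: $\tfrac{1}{2}\mathbb{Z} = \{k/2 : k \in \mathbb{Z}\}$ denotes the set of half-integers (including integers). An $\ell_1$-odd-distance set in $\mathbb{R}^n$ is a set of points such that all pairwise $\ell_1$-distances (for distinct points) are odd integers. $\mathrm{odd}_1(n)$ denotes the maximum size of an $\ell_1$-odd-distance set in $\mathbb{R}^n$. *)

theory Defs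
  imports Complex_Main "HOL-Library.FuncSet" "HOL-Library.Extended_Nat"
begin

definition half_ints :: "real set" where
  "half_ints = {of_int k / 2 | k :: int. True}"

text \<open>
  \<open>vecs A n\<close> is \<open>A^n\<close>: vectors are functions on the index set \<open>{1..n}\<close>, made extensional
  (equal to \<open>undefined\<close> outside it), so that equality of functions is equality of vectors
  and cardinalities are the intended ones.
\<close>

definition vecs :: "real set \<Rightarrow> nat \<Rightarrow> (nat \<Rightarrow> real) set" where
  "vecs A n = {1..n} \<rightarrow>\<^sub>E A"

definition l1_dist :: "nat \<Rightarrow> (nat \<Rightarrow> real) \<Rightarrow> (nat \<Rightarrow> real) \<Rightarrow> real" where
  "l1_dist n p q = (\<Sum>i=1..n. \<bar>p i - q i\<bar>)"

definition l1_odd_distance_set :: "nat \<Rightarrow> (nat \<Rightarrow> real) set \<Rightarrow> bool" where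
  "l1_odd_distance_set n P \<longleftrightarrow> P \<subseteq> vecs UNIV n \<and>
     (\<forall>p\<in>P. \<forall>q\<in>P. p \<noteq> q \<longrightarrow> (\<exists>k::int. odd k \<and> l1_dist n p q = of_int k))"

text \<open>
  The maximum size, taken as a supremum in \<^typ>\<open>enat\<close> so that no a priori bound is needed for
  it to be meaningful: if the sizes of the finite sets are bounded, the supremum is attained and
  is their maximum; otherwise it is \<open>\<infinity>\<close>. Infinite sets need not be included, since subsets of
  \<open>\<ell>\<^sub>1\<close>-odd-distance sets are again such sets.
\<close>

definition odd1 :: "nat \<Rightarrow> enat" where
  "odd1 n = (SUP P \<in> {P. finite P \<and> l1_odd_distance_set n P}. enat (card P))"

end

theory Submission
  imports Defs
begin

text \<open>
  After scaling by 2, one needs integer vectors with pairwise \<open>\<ell>\<^sub>1\<close>-distances congruent to 2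
  modulo 4. It suffices to find \<open>2^(n-1)\<close> nonnegative such vectors whose coordinate sums are
  congruent to 1 modulo 4: adjoining their negatives doubles the set, because the distance
  from \<open>v\<close> to \<open>- w\<close> is the sum of the coordinates of \<open>v\<close> and \<open>w\<close>.
  Such a set passes from dimension \<open>n\<close> to \<open>n + 1\<close>: extend one copy by the coordinate 4; translate
  a second copy by \<open>(4M + 1, 4M, \<dots>, 4M)\<close> with \<open>M\<close> large, and extend it by the coordinate 3.
  The coordinate sums are unchanged modulo 4, and since the translated copy dominates
  the other one in all old coordinates, the mixed distances are \<open>1 + 1\<close> modulo 4.
\<close>

lemma nonneg_int_vectors_dist_2_mod_4:
  "\<exists>(f :: nat \<Rightarrow> nat \<Rightarrow> int) M. (\<forall>k i. 0 \<le> f k i \<and> f k i \<le> M) \<and>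
     (\<forall>k<2 ^ m. (\<Sum>i=1..Suc m. f k i) mod 4 = 1) \<and>
     (\<forall>k<2 ^ m. \<forall>l<k. (\<Sum>i=1..Suc m. \<bar>f k i - f l i\<bar>) mod 4 = 2)"
proof (induction m)
  case 0
  show ?case
    by (rule exI[of _ "\<lambda>_ _. 1"], rule exI[of _ 1]) simp
next
  case (Suc m)
  then obtain f :: "nat \<Rightarrow> nat \<Rightarrow> int" and M where
    bnd: "\<And>k i. 0 \<le> f k i" "\<And>k i. f k i \<le> M" and
    sum: "\<And>k. k < 2 ^ m \<Longrightarrow> (\<Sum>i=1..Suc m. f k i) mod 4 = 1" and
    dist: "\<And>k l. k < 2 ^ m \<Longrightarrow> l < k \<Longrightarrow> (\<Sum>i=1..Suc m. \<bar>f k i - f l i\<bar>) mod 4 = 2"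
    by metis
  define N :: nat where "N = 2 ^ m"
  define t :: "nat \<Rightarrow> int" where "t i = 4 * M + (if i = 1 then 1 else 0)" for i
  \<comment> \<open>Indices below \<open>N\<close> carry the untranslated copy, indices from
    \<open>N\<close> to \<open>2 * N - 1\<close> the translated one; \<open>Suc (Suc m)\<close> is
    the new coordinate.\<close>
  define g where "g k i = (if i = Suc (Suc m) then (if k < N then 4 else 3)
      else if k < N then f k i else f (k - N) i + t i)" for k i
  have M: "0 \<le> M"
    using bnd[of 0 0] by linarith
  have sum_t: "(\<Sum>i=1..Suc m. t i) = 4 * (int (Suc m) * M) + 1"
    unfolding t_def sum.distrib by (simp add: sum.delta algebra_simps)
  have sum_Suc: "(\<Sum>i=1..Suc (Suc m). h i) = (\<Sum>i=1..Suc m. h i) + h (Suc (Suc m))"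
    for h :: "nat \<Rightarrow> int"
    by simp
  have g_low: "g k i = f k i" if "k < N" "i \<in> {1..Suc m}" for k i
    using that by (simp add: g_def)
  have g_high: "g k i = f (k - N) i + t i" if "\<not> k < N" "i \<in> {1..Suc m}" for k i
    using that by (simp add: g_def)
  \<comment> \<open>Translated entries are at most \<open>M + (4 * M + 1)\<close> and the new
    coordinate is at most 4, so \<open>5 * M + 4\<close> covers both.\<close>
  have g_bnd: "0 \<le> g k i" "g k i \<le> 5 * M + 4" for k i
    using bnd[of k i] bnd[of "k - N" i] M by (auto simp: g_def t_def)
  have g_sum: "(\<Sum>i=1..Suc (Suc m). g k i) mod 4 = 1" if "k < 2 ^ Suc m" for k
  proof (cases "k < N")
    case True
    have "(\<Sum>i=1..Suc (Suc m). g k i) = (\<Sum>i=1..Suc m. f k i) + 4"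
      unfolding sum_Suc using True g_low by (simp add: g_def)
    then show ?thesis
      using sum[of k] True by (simp add: N_def)
  next
    case False
    have "(\<Sum>i=1..Suc m. g k i) = (\<Sum>i=1..Suc m. f (k - N) i) + (\<Sum>i=1..Suc m. t i)"
      unfolding sum.distrib[symmetric] by (intro sum.cong refl g_high[OF False])
    \<comment> \<open>The final 4 is the 1 left over from \<open>sum_t\<close> plus the new
      coordinate 3.\<close>
    then have "(\<Sum>i=1..Suc (Suc m). g k i)
        = (\<Sum>i=1..Suc m. f (k - N) i) + 4 * (int (Suc m) * M) + 4"
      unfolding sum_Suc sum_t using False by (simp add: g_def)
    moreover have "(\<Sum>i=1..Suc m. f (k - N) i) mod 4 = 1"
      using False that by (intro sum) (simp add: N_def)
    ultimately show ?thesis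
      by presburger
  qed
  have g_dist: "(\<Sum>i=1..Suc (Suc m). \<bar>g k i - g l i\<bar>) mod 4 = 2"
    if "k < 2 ^ Suc m" "l < k" for k l
  proof -
    consider "k < N" | "\<not> l < N" | "\<not> k < N" "l < N"
      by blast
    then show ?thesis
    proof cases
      case 1
      then have "(\<Sum>i=1..Suc (Suc m). \<bar>g k i - g l i\<bar>) = (\<Sum>i=1..Suc m. \<bar>f k i - f l i\<bar>)"
        unfolding sum_Suc using \<open>l < k\<close> g_low by (simp add: g_def)
      then show ?thesis
        using dist[of k l] 1 \<open>l < k\<close> by (simp add: N_def)
    next
      case 2
      then have "(\<Sum>i=1..Suc (Suc m). \<bar>g k i - g l i\<bar>)
          = (\<Sum>i=1..Suc m. \<bar>f (k - N) i - f (l - N) i\<bar>)"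
        unfolding sum_Suc using \<open>l < k\<close> g_high by (simp add: g_def)
      moreover have "k - N < 2 ^ m" "l - N < k - N"
        using 2 that by (auto simp: N_def)
      ultimately show ?thesis
        using dist[of "k - N" "l - N"] by presburger
    next
      case 3
      \<comment> \<open>The absolute value opens because \<open>t i\<close> is at least
        \<open>4 * M\<close>, hence at least \<open>M\<close> and so at least
        \<open>f l i\<close>.\<close>
      have "\<bar>g k i - g l i\<bar> = f (k - N) i + t i - f l i" if "i \<in> {1..Suc m}" for i
        using g_high[OF 3(1) that] g_low[OF 3(2) that] bnd[of "k - N" i] bnd[of l i] M
        by (auto simp: t_def)
      then have "(\<Sum>i=1..Suc m. \<bar>g k i - g l i\<bar>)
          = (\<Sum>i=1..Suc m. f (k - N) i) + (\<Sum>i=1..Suc m. t i) - (\<Sum>i=1..Suc m. f l i)"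
        unfolding sum.distrib[symmetric] sum_subtractf[symmetric] by (intro sum.cong refl)
      \<comment> \<open>The 2 combines the 1 from \<open>sum_t\<close> with the gap between 3 and 4
        in the new coordinate; the two sums of \<open>f\<close> cancel modulo 4.\<close>
      then have "(\<Sum>i=1..Suc (Suc m). \<bar>g k i - g l i\<bar>)
          = (\<Sum>i=1..Suc m. f (k - N) i) - (\<Sum>i=1..Suc m. f l i) + 4 * (int (Suc m) * M) + 2"
        unfolding sum_Suc sum_t using 3 by (simp add: g_def)
      moreover have kl: "k - N < 2 ^ m" "l < 2 ^ m"
        using 3 that by (auto simp: N_def)
      ultimately show ?thesis
        using sum[OF kl(1)] sum[OF kl(2)] by presburger
    qed
  qed
  show ?case
    by (intro exI[of _ g] exI[of _ "5 * M + 4"] conjI allI impI g_bnd g_sum g_dist)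
qed

text \<open>Undoes the scaling by 2: half of \<open>4 * j + 2\<close> is
  \<open>2 * j + 1\<close>.\<close>

lemma odd_half_of_2_mod_4:
  fixes s :: int
  assumes "s mod 4 = 2"
  shows "\<exists>k::int. odd k \<and> of_int s / 2 = (of_int k :: real)"
proof (intro exI conjI)
  show "odd (s div 2)"
    using assms by presburger
  have "s = 2 * (s div 2)"
    using assms by presburger
  then have "(of_int s :: real) = 2 * of_int (s div 2)"
    by (metis of_int_mult of_int_numeral)
  then show "of_int s / 2 = (of_int (s div 2) :: real)"
    by simp
qed

lemma l1_dist_commute: "l1_dist n p q = l1_dist n q p"
  by (simp add: l1_dist_def abs_minus_commute)

lemma half_int_odd_distance_set_exists:
  assumes "n \<ge> 1"
  shows "\<exists>P. P \<subseteq> vecs half_ints n \<and> card P = 2 ^ n \<and>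
    (\<forall>p\<in>P. \<forall>q\<in>P. p \<noteq> q \<longrightarrow> (\<exists>k::int. odd k \<and> l1_dist n p q = of_int k))"
proof -
  obtain m where n: "n = Suc m"
    using assms by (cases n) auto
  obtain f :: "nat \<Rightarrow> nat \<Rightarrow> int" where
    nonneg: "\<And>k i. 0 \<le> f k i" and
    sum: "\<And>k. k < 2 ^ m \<Longrightarrow> (\<Sum>i=1..n. f k i) mod 4 = 1" and
    dist: "\<And>k l. k < 2 ^ m \<Longrightarrow> l < k \<Longrightarrow> (\<Sum>i=1..n. \<bar>f k i - f l i\<bar>) mod 4 = 2"
    using nonneg_int_vectors_dist_2_mod_4[of m] unfolding n by metis
  define N :: nat where "N = 2 ^ m"
  \<comment> \<open>The upper half of the indices lists the negatives.\<close>
  define g where "g k i = (if k < N then f k i else - f (k - N) i)" for k i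
  define p where "p k = (\<lambda>i\<in>{1..n}. (of_int (g k i) / 2 :: real))" for k
  have dist_p: "l1_dist n (p k) (p l) = of_int (\<Sum>i=1..n. \<bar>g k i - g l i\<bar>) / 2" for k l
  proof -
    have "\<bar>p k i - p l i\<bar> = of_int \<bar>g k i - g l i\<bar> / 2" if "i \<in> {1..n}" for i
      using that by (simp add: p_def flip: diff_divide_distrib)
    then show ?thesis
      unfolding l1_dist_def of_int_sum sum_divide_distrib by (intro sum.cong refl)
  qed
  have dist_g: "(\<Sum>i=1..n. \<bar>g k i - g l i\<bar>) mod 4 = 2" if "k < 2 ^ n" "l < k" for k l
  proof -
    consider "k < N" | "\<not> l < N" | "\<not> k < N" "l < N"
      by blast
    then show ?thesis
    proof cases
      case 1
      then show ?thesis
        using dist[of k l] \<open>l < k\<close> by (simp add: g_def N_def)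
    next
      case 2
      then have "(\<Sum>i=1..n. \<bar>g k i - g l i\<bar>) = (\<Sum>i=1..n. \<bar>f (k - N) i - f (l - N) i\<bar>)"
        using \<open>l < k\<close> by (simp add: g_def abs_minus_commute)
      then show ?thesis
        using dist[of "k - N" "l - N"] 2 that by (simp add: N_def n)
    next
      case 3
      \<comment> \<open>Here nonnegativity is essential: a negated vector and an original one have
        opposite signs in each coordinate, so the distance is a sum of two coordinate sums, each 1
        modulo 4.\<close>
      then have "\<bar>g k i - g l i\<bar> = f (k - N) i + f l i" for i
        using nonneg[of "k - N" i] nonneg[of l i] by (simp add: g_def)
      then have "(\<Sum>i=1..n. \<bar>g k i - g l i\<bar>) = (\<Sum>i=1..n. f (k - N) i) + (\<Sum>i=1..n. f l i)"
        by (simp add: sum.distrib)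
      moreover have kl: "k - N < 2 ^ m" "l < 2 ^ m"
        using 3 that by (auto simp: N_def n)
      ultimately show ?thesis
        using sum[OF kl(1)] sum[OF kl(2)] by presburger
    qed
  qed
  have odd_dist_less: "\<exists>j::int. odd j \<and> l1_dist n (p k) (p l) = of_int j"
    if "k < 2 ^ n" "l < k" for k l
    unfolding dist_p by (rule odd_half_of_2_mod_4[OF dist_g[OF that]])
  have odd_dist: "\<exists>j::int. odd j \<and> l1_dist n (p k) (p l) = of_int j"
    if "k < 2 ^ n" "l < 2 ^ n" "k \<noteq> l" for k l
    using odd_dist_less[of k l] odd_dist_less[of l k] that
    unfolding l1_dist_commute[of n "p l" "p k"] nat_neq_iff by blast
  \<comment> \<open>Equal vectors are at distance 0, which is not odd.\<close>
  have "inj_on p {..<2 ^ n}"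
  proof (rule inj_onI, rule ccontr)
    fix k l assume kl: "k \<in> {..<2 ^ n}" "l \<in> {..<2 ^ n}" "p k = p l" "k \<noteq> l"
    have "l1_dist n (p k) (p l) = 0"
      using kl by (simp add: l1_dist_def)
    then show False
      using odd_dist[of k l] kl by auto
  qed
  then have "card (p ` {..<2 ^ n}) = 2 ^ n"
    by (simp add: card_image)
  moreover have "p ` {..<2 ^ n} \<subseteq> vecs half_ints n"
    by (auto simp: vecs_def half_ints_def p_def)
  moreover have "\<exists>j::int. odd j \<and> l1_dist n a b = of_int j"
    if ab: "a \<in> p ` {..<2 ^ n}" "b \<in> p ` {..<2 ^ n}" "a \<noteq> b" for a b
  proof -
    obtain k l where "a = p k" "k < 2 ^ n" "b = p l" "l < 2 ^ n"
      using ab by blast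
    moreover from this have "k \<noteq> l"
      using \<open>a \<noteq> b\<close> by blast
    ultimately show ?thesis
      using odd_dist by simp
  qed
  ultimately show ?thesis
    by blast
qed

theorem theorem1p1:
  fixes n :: nat
  assumes "n \<ge> 1"
  shows "(\<exists>P. P \<subseteq> vecs half_ints n \<and> card P = 2 ^ n \<and>
            (\<forall>p\<in>P. \<forall>q\<in>P. p \<noteq> q \<longrightarrow> (\<exists>k::int. odd k \<and> l1_dist n p q = of_int k)))
         \<and> odd1 n \<ge> 2 ^ n"
proof
  show "\<exists>P. P \<subseteq> vecs half_ints n \<and> card P = 2 ^ n \<and>
      (\<forall>p\<in>P. \<forall>q\<in>P. p \<noteq> q \<longrightarrow> (\<exists>k::int. odd k \<and> l1_dist n p q = of_int k))"
    using half_int_odd_distance_set_exists[OF assms] .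
  then obtain P where P: "P \<subseteq> vecs half_ints n" "card P = 2 ^ n"
    "\<forall>p\<in>P. \<forall>q\<in>P. p \<noteq> q \<longrightarrow> (\<exists>k::int. odd k \<and> l1_dist n p q = of_int k)"
    by blast
  have "vecs half_ints n \<subseteq> vecs UNIV n"
    unfolding vecs_def by (intro PiE_mono) simp
  then have "l1_odd_distance_set n P"
    using P unfolding l1_odd_distance_set_def by blast
  \<comment> \<open>An infinite set has \<open>card\<close> 0, which differs from
    \<open>2 ^ n\<close>.\<close>
  moreover have "finite P"
    using P(2) by (intro card_ge_0_finite) simp
  ultimately have "enat (card P) \<le> odd1 n"
    unfolding odd1_def by (intro SUP_upper) simp
  moreover have "enat (2 ^ n) = 2 ^ n"
    by (induction n) (simp_all add: one_enat_def numeral_eq_enat flip: times_enat_simps)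
  ultimately show "2 ^ n \<le> odd1 n"
    using P(2) by simp
qed

end
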